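(* Let $f:\{0,1\}^n\times\{0,1\}^n\to[-1,1]$ and $\varepsilon\in(0,1]$, and suppose $\mathrm{rank}_{\varepsilon/2}(f)=r$. Then $\bar{\mathrm{D}}_\varepsilon(f)\le O(rn+r\log(1/\varepsilon))$.
   Context: $A_f$ is the $2^n\times 2^n$ real matrix with $(x,y)$ entry $f(x,y)$. The $\varepsilon$-approximate rank $\mathrm{rank}_\varepsilon(f)$ is the minimum rank of a real matrix $B$ with $\max_{x,y}|A_f(x,y)-B(x,y)|\le\varepsilon$. Distributed estimation: Alice holds a probability distribution $p$ on $\{0,1\}^n$, Bob holds a probability distribution $q$ on $\{0,1\}^n$, and they must output a value within additive error $\varepsilon$ of $\mathbb{E}_{x\sim p,y\sim q}[f(x,y)]$. $\bar{\mathrm{D}}_\varepsilon(f)$ is the minimum worst-case communication (in bits) of a deterministic protocol that does so for every input pair $(p,q)$. $O$ hides an absolute constant. *)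

theory Defs
  imports "HOL-Probability.Probability_Mass_Function" "HOL-Library.Extended_Real"
    "Jordan_Normal_Form.DL_Rank"
begin

definition cube :: "nat \<Rightarrow> bool list set" where
  "cube n = {x. length x = n}"

text \<open>Matrices are indexed by numbers below \<open>2 ^ n\<close>, so rows and columns are labelled by the
  bit strings of length \<open>n\<close> through a fixed enumeration of the cube.\<close>

definition bitstring :: "nat \<Rightarrow> nat \<Rightarrow> bool list" where
  "bitstring n i = List.n_lists n [False, True] ! i"

lemma bij_betw_bitstring: "bij_betw (bitstring n) {..<2 ^ n} (cube n)"
proof -
  have "bij_betw ((!) (List.n_lists n [False, True])) {..<length (List.n_lists n [False, True])}
          (set (List.n_lists n [False, True]))"
    by (intro bij_betw_nth distinct_n_lists) auto
  moreover have "set (List.n_lists n [False, True]) = cube n"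
    by (auto simp: set_n_lists cube_def)
  moreover have "bitstring n = (!) (List.n_lists n [False, True])"
    by (simp add: bitstring_def fun_eq_iff)
  ultimately show ?thesis
    by (simp add: length_n_lists numeral_2_eq_2)
qed

definition comm_matrix :: "nat \<Rightarrow> (bool list \<Rightarrow> bool list \<Rightarrow> real) \<Rightarrow> real mat" where
  "comm_matrix n f = mat (2 ^ n) (2 ^ n) (\<lambda>(i, j). f (bitstring n i) (bitstring n j))"

definition approx_rank :: "nat \<Rightarrow> real \<Rightarrow> (bool list \<Rightarrow> bool list \<Rightarrow> real) \<Rightarrow> nat" where
  "approx_rank n \<epsilon> f = Inf {vec_space.rank (2 ^ n) B | B.
     B \<in> carrier_mat (2 ^ n) (2 ^ n) \<and>
     (\<forall>i<2 ^ n. \<forall>j<2 ^ n. \<bar>comm_matrix n f $$ (i, j) - B $$ (i, j)\<bar> \<le> \<epsilon>)}"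

text \<open>A protocol is a binary tree. At an inner node its owner sends one bit, which depends on the
  owner's input only (the history is the position in the tree). The output is a function of the
  transcript, hence known to both parties.\<close>

datatype ('a, 'b) protocol =
    Output real
  | Alice "'a \<Rightarrow> bool" "('a, 'b) protocol" "('a, 'b) protocol"
  | Bob "'b \<Rightarrow> bool" "('a, 'b) protocol" "('a, 'b) protocol"

primrec run :: "('a, 'b) protocol \<Rightarrow> 'a \<Rightarrow> 'b \<Rightarrow> real" where
  "run (Output v) a b = v"
| "run (Alice s P Q) a b = (if s a then run P a b else run Q a b)"
| "run (Bob s P Q) a b = (if s b then run P a b else run Q a b)"

primrec cost :: "('a, 'b) protocol \<Rightarrow> nat" where
  "cost (Output v) = 0"
| "cost (Alice s P Q) = Suc (max (cost P) (cost Q))"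
| "cost (Bob s P Q) = Suc (max (cost P) (cost Q))"

definition dists :: "nat \<Rightarrow> bool list pmf set" where
  "dists n = {p. set_pmf p \<subseteq> cube n}"

definition estimates ::
    "nat \<Rightarrow> real \<Rightarrow> (bool list \<Rightarrow> bool list \<Rightarrow> real) \<Rightarrow> (bool list pmf, bool list pmf) protocol \<Rightarrow> bool" where
  "estimates n \<epsilon> f P \<longleftrightarrow> (\<forall>p\<in>dists n. \<forall>q\<in>dists n.
     \<bar>run P p q - measure_pmf.expectation (pair_pmf p q) (\<lambda>(x, y). f x y)\<bar> \<le> \<epsilon>)"

text \<open>Valued in \<open>enat\<close>, so that it would be infinite if no protocol existed.\<close>

definition D_bar :: "nat \<Rightarrow> real \<Rightarrow> (bool list \<Rightarrow> bool list \<Rightarrow> real) \<Rightarrow> enat" where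
  "D_bar n \<epsilon> f = Inf {enat (cost P) | P. estimates n \<epsilon> f P}"

end

theory Submission
  imports Defs
begin

text \<open>Let \<open>B\<close> be a matrix of rank \<open>r\<close> that approximates \<open>f\<close> within \<open>\<epsilon> / 2\<close>. There are \<open>r\<close> columns
  of \<open>B\<close> such that every column is a combination of them with coefficients in \<open>[-1, 1]\<close>: take the
  columns that span the largest volume. Averaging over Bob's distribution turns \<open>p\<^sup>T B q\<close> into
  \<open>\<Sum>i. \<beta>\<^sub>i \<alpha>\<^sub>i\<close>, where Bob knows the \<open>\<beta>\<^sub>i \<in> [-1, 1]\<close> and Alice knows the \<open>\<alpha>\<^sub>i \<in> [-3/2, 3/2]\<close>.
  Since \<open>r \<le> 2 ^ n\<close>, it suffices that Bob sends every \<open>\<beta>\<^sub>i\<close> to precision of order \<open>\<epsilon> / 2 ^ n\<close>, which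
  takes \<open>n + log (1 / \<epsilon>) + O(1)\<close> bits each; Alice answers with the rounded value of the sum. The
  cases \<open>n = 0\<close> and \<open>r = 0\<close> are separate because there the bound leaves no room for the additive
  constants.\<close>

unbundle no vec_syntax

section \<open>Columns that generate a matrix with bounded coefficients\<close>

text \<open>Take an inclusion-maximal independent set of columns. A column outside its span could be
  added to it, against maximality.\<close>

lemma (in vec_space) cols_subset_span_rank:
  assumes A: "A \<in> carrier_mat n nc"
  obtains S where "S \<subseteq> set (cols A)" "card S = rank A" "set (cols A) \<subseteq> span S"
proof -
  let ?P = "\<lambda>T. T \<subseteq> set (cols A) \<and> lin_indpt T"
  have carr: "set (cols A) \<subseteq> carrier_vec n" using cols_dim A by blast
  have "?P {}" by (simp add: finite_lin_indpt2)
  then obtain S where S: "maximal S ?P"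
    using maximal_exists_superset[of "set (cols A)" ?P "{}"] by auto
  then have SP: "S \<subseteq> set (cols A)" "lin_indpt S" by (auto simp: maximal_def)
  have "v \<in> span S" if v: "v \<in> set (cols A)" for v
  proof (rule ccontr)
    assume n: "v \<notin> span S"
    then have "v \<notin> S" using span_mem[of S v] SP carr by auto
    moreover have "lin_indpt (S \<union> {v})"
      using lin_dep_iff_in_span[of S v] SP carr n v \<open>v \<notin> S\<close> by auto
    ultimately show False using S v SP unfolding maximal_def by blast
  qed
  then show ?thesis using that[of S] SP rank_card_indpt[OF A S] by auto
qed

text \<open>Passes from a set of columns to column indices and entrywise sums. Injectivity of
  \<open>j\<close> later makes the coefficient matrix of the chosen columns the identity.\<close>

lemma (in vec_space) rank_many_columns_generate:
  assumes A: "A \<in> carrier_mat n nc"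
  obtains j :: "nat \<Rightarrow> nat" and W where "inj_on j {..<rank A}" "\<And>i. i < rank A \<Longrightarrow> j i < nc"
    "\<And>x y. x < n \<Longrightarrow> y < nc \<Longrightarrow> A $$ (x, y) = (\<Sum>i<rank A. A $$ (x, j i) * W i y)"
proof -
  obtain S where S: "S \<subseteq> set (cols A)" "card S = rank A" "set (cols A) \<subseteq> span S"
    using cols_subset_span_rank[OF A] .
  have fin: "finite S" using S(1) finite_subset by blast
  have carr: "S \<subseteq> carrier_vec n" using S(1) cols_dim A by blast
  obtain e where e: "bij_betw e {..<rank A} S"
    using ex_bij_betw_nat_finite[OF fin] S(2) by (auto simp: atLeast0LessThan)
  have "\<exists>y<nc. col A y = e i" if "i < rank A" for i
  proof -
    have "e i \<in> set (cols A)" using e that S(1) by (auto simp: bij_betw_def)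
    then show ?thesis using A unfolding cols_def by auto
  qed
  then obtain j where j: "\<And>i. i < rank A \<Longrightarrow> j i < nc \<and> col A (j i) = e i" by metis
  have "\<exists>a. col A y = lincomb a S" if "y < nc" for y
  proof -
    have "col A y \<in> span S" using S(3) that A unfolding cols_def by auto
    then obtain a where "lincomb a S = col A y" using finite_in_span[OF fin] carr by auto
    then show ?thesis by metis
  qed
  then obtain a where a: "\<And>y. y < nc \<Longrightarrow> col A y = lincomb (a y) S" by metis
  show ?thesis
  proof (rule that[of j "\<lambda>i y. a y (e i)"])
    show "inj_on j {..<rank A}"
      using j e by (metis (no_types, lifting) bij_betw_def inj_on_def lessThan_iff)
    show "j i < nc" if "i < rank A" for i using j that by blast
    fix x y assume x: "x < n" and y: "y < nc"
    have "A $$ (x, y) = col A y $ x" using A x y by simp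
    also have "\<dots> = (\<Sum>v\<in>S. a y v * v $ x)" using a[OF y] lincomb_index[OF x carr] by simp
    also have "\<dots> = (\<Sum>i<rank A. a y (e i) * e i $ x)"
      using sum.reindex_bij_betw[OF e, of "\<lambda>v. a y v * v $ x"] by simp
    also have "\<dots> = (\<Sum>i<rank A. A $$ (x, j i) * a y (e i))"
    proof (rule sum.cong)
      fix i assume "i \<in> {..<rank A}"
      then have "e i $ x = A $$ (x, j i)" using j[of i] A x by (metis carrier_matD index_col lessThan_iff)
      then show "a y (e i) * e i $ x = A $$ (x, j i) * a y (e i)" by simp
    qed simp
    finally show "A $$ (x, y) = (\<Sum>i<rank A. A $$ (x, j i) * a y (e i))" .
  qed
qed

text \<open>Among all choices of \<open>r\<close> columns, one maximising the absolute value of the determinant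
  of the coefficient matrix works: by Cramer's rule the new coefficients are quotients of such
  determinants by the maximal one.\<close>

lemma generating_columns_bounded_coefficients:
  fixes B W :: "nat \<Rightarrow> nat \<Rightarrow> real"
  assumes inj: "inj_on j {..<r}" and jN: "\<And>i. i < r \<Longrightarrow> j i < N"
    and BW: "\<And>x y. x < m \<Longrightarrow> y < N \<Longrightarrow> B x y = (\<Sum>i<r. B x (j i) * W i y)"
  obtains k :: "nat \<Rightarrow> nat" and c where "\<And>i. i < r \<Longrightarrow> k i < N"
    "\<And>i y. i < r \<Longrightarrow> y < N \<Longrightarrow> \<bar>c i y\<bar> \<le> 1"
    "\<And>x y. x < m \<Longrightarrow> y < N \<Longrightarrow> B x y = (\<Sum>i<r. B x (k i) * c i y)"
proof -
  \<comment> \<open>The generating columns may be dependent as far as the hypotheses tell, so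
    \<open>W\<close> may express column \<open>j l\<close> in another way than as itself.
    \<open>V\<close> forces the unit vector there.\<close>
  define V where "V i y = (if y \<in> j ` {..<r} then of_bool (j i = y) else W i y)" for i y
  have BV: "B x y = (\<Sum>i<r. B x (j i) * V i y)" if "x < m" "y < N" for x y
  proof (cases "y \<in> j ` {..<r}")
    case True
    then obtain l where l: "l < r" "y = j l" by auto
    have "(\<Sum>i<r. B x (j i) * V i y) = (\<Sum>i<r. if i = l then B x (j i) else 0)"
      using l inj by (intro sum.cong) (auto simp: V_def inj_on_def)
    then show ?thesis using l by simp
  next
    case False
    then show ?thesis using BW that by (simp add: V_def)
  qed
  define M where "M k = mat r r (\<lambda>(a, i). V a (k i))" for k :: "nat \<Rightarrow> nat"
  \<comment> \<open>Choices with repeated columns are allowed: their determinant is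
    \<open>0\<close>, and \<open>K\<close> is then a plain finite product, closed under changing one
    index.\<close>
  define K where "K = PiE {..<r} (\<lambda>_. {..<N})"
  have Mc: "M k \<in> carrier_mat r r" for k by (simp add: M_def)
  have fin: "finite K" unfolding K_def by (intro finite_PiE) auto
  have jK: "restrict j {..<r} \<in> K" using jN by (auto simp: K_def)
  \<comment> \<open>The original choice has determinant 1, so the maximum is at least 1 and the
    maximiser \<open>k\<close> has an invertible matrix.\<close>
  have "M (restrict j {..<r}) = 1\<^sub>m r"
    using inj by (intro eq_matI) (auto simp: M_def V_def inj_on_def)
  then have dj: "det (M (restrict j {..<r})) = 1" by simp
  define D where "D = Max ((\<lambda>k. \<bar>det (M k)\<bar>) ` K)"
  have "D \<in> (\<lambda>k. \<bar>det (M k)\<bar>) ` K" unfolding D_def using fin jK by (intro Max_in) auto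
  then obtain k where kK: "k \<in> K" and kD: "\<bar>det (M k)\<bar> = D" by auto
  have Dmax: "\<bar>det (M l)\<bar> \<le> D" if "l \<in> K" for l unfolding D_def using fin that by (intro Max_ge) auto
  have "D \<ge> 1" using Dmax[OF jK] dj by simp
  then have d0: "det (M k) \<noteq> 0" using kD by auto
  have "\<exists>c. (\<forall>i<r. \<bar>c i\<bar> \<le> 1) \<and> (\<forall>a<r. V a y = (\<Sum>i<r. V a (k i) * c i))" if y: "y < N" for y
  proof -
    define w where "w = vec r (\<lambda>a. V a y)"
    \<comment> \<open>This is the inverse of \<open>M k\<close> applied to \<open>w\<close>, with
      the inverse written through the adjugate.\<close>
    define z where "z = (1 / det (M k)) \<cdot>\<^sub>v (adj_mat (M k) *\<^sub>v w)"
    have wc: "w \<in> carrier_vec r" by (simp add: w_def)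
    note adj = adj_mat[OF Mc[of k]]
    have zc: "z \<in> carrier_vec r" using adj(1) wc by (simp add: z_def)
    have "(d \<cdot>\<^sub>m 1\<^sub>m r) *\<^sub>v w = d \<cdot>\<^sub>v w" for d :: real
      using wc by (intro eq_vecI) (auto simp: scalar_prod_def if_distrib if_distribR cong: if_cong)
    then have "M k *\<^sub>v (adj_mat (M k) *\<^sub>v w) = det (M k) \<cdot>\<^sub>v w"
      using assoc_mult_mat_vec[OF Mc adj(1) wc, of k] adj(2) by simp
    then have Mz: "M k *\<^sub>v z = w"
      unfolding z_def using mult_mat_vec[OF Mc, of "adj_mat (M k) *\<^sub>v w" k] adj(1) wc d0
      by (simp add: smult_smult_assoc)
    have "\<bar>z $ i\<bar> \<le> 1" if i: "i < r" for i
    proof -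
      \<comment> \<open>Replacing column \<open>i\<close> by \<open>w\<close> gives the matrix of
        another choice in \<open>K\<close>, so the numerator in Cramer's rule is bounded by the
        maximal determinant.\<close>
      have "replace_col (M k) w i = M (k(i := y))"
        using i by (intro eq_matI) (auto simp: replace_col_def M_def w_def)
      then have "det (M (k(i := y))) = z $ i * det (M k)"
        using cramer_lemma_mat[OF Mc zc i, of k] Mz by simp
      moreover have "k(i := y) \<in> K" using kK y i by (auto simp: K_def PiE_iff extensional_def)
      ultimately have "\<bar>z $ i\<bar> * \<bar>det (M k)\<bar> \<le> \<bar>det (M k)\<bar>" using Dmax kD by (metis abs_mult)
      then show ?thesis using d0 by simp
    qed
    moreover have "V a y = (\<Sum>i<r. V a (k i) * z $ i)" if a: "a < r" for a
    proof -
      have "V a y = (M k *\<^sub>v z) $ a" using Mz a by (simp add: w_def)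
      also have "\<dots> = (\<Sum>i<r. V a (k i) * z $ i)"
        using a zc Mc[of k] by (simp add: scalar_prod_def atLeast0LessThan M_def)
      finally show ?thesis .
    qed
    ultimately show ?thesis by blast
  qed
  then obtain c where c: "\<And>y. y < N \<Longrightarrow> (\<forall>i<r. \<bar>c y i\<bar> \<le> 1) \<and> (\<forall>a<r. V a y = (\<Sum>i<r. V a (k i) * c y i))"
    by metis
  have kN: "k i < N" if "i < r" for i using kK that by (auto simp: K_def)
  show ?thesis
  proof (rule that[of k "\<lambda>i y. c y i"])
    fix x y assume x: "x < m" and y: "y < N"
    \<comment> \<open>Column \<open>y\<close> of \<open>V\<close> is a combination of its columns
      \<open>k i\<close>; multiplying by the columns \<open>j a\<close> of \<open>B\<close> carries
      this relation over to \<open>B\<close>.\<close>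
    have "B x y = (\<Sum>a<r. B x (j a) * (\<Sum>i<r. V a (k i) * c y i))" using BV[OF x y] c[OF y] by simp
    also have "\<dots> = (\<Sum>i<r. \<Sum>a<r. B x (j a) * V a (k i) * c y i)"
      by (subst sum.swap) (simp add: sum_distrib_left mult.assoc)
    also have "\<dots> = (\<Sum>i<r. B x (k i) * c y i)"
      using BV[OF x kN] by (simp add: sum_distrib_right)
    finally show "B x y = (\<Sum>i<r. B x (k i) * c y i)" .
  qed (use kN c in auto)
qed

section \<open>Protocols that send one element of a finite set\<close>

text \<open>Each bit of Bob tells which of two parts of \<open>S\<close> contains
  \<open>g b\<close>. After \<open>k\<close> bits at most one candidate \<open>s\<close> is left,
  and \<open>P s\<close> continues.\<close>

lemma ex_protocol_Bob_sends:
  assumes "finite S" "card S \<le> 2 ^ k" "\<And>s. s \<in> S \<Longrightarrow> cost (P s) \<le> c"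
  shows "\<exists>Q. cost Q \<le> k + c \<and> (\<forall>a b. g b \<in> S \<longrightarrow> run Q a b = run (P (g b)) a b)"
  using assms
proof (induction k arbitrary: S)
  case 0
  show ?case
  proof (cases "S = {}")
    case True
    \<comment> \<open>No input reaches this leaf with \<open>g b\<close> in \<open>S\<close>, so its
      output is arbitrary.\<close>
    then show ?thesis by (intro exI[of _ "Output 0"]) auto
  next
    case False
    then have "card S = 1" using 0 by (metis One_nat_def card_0_eq le_Suc_eq le_zero_eq power_0)
    then obtain s where "S = {s}" by (auto simp: card_1_singleton_iff)
    then show ?thesis using 0 by (intro exI[of _ "P s"]) auto
  qed
next
  case (Suc k)
  \<comment> \<open>\<open>T\<close> is filled up to \<open>2 ^ k\<close> elements if
    \<open>S\<close> has that many, so that the rest also has at most \<open>2 ^ k\<close>.\<close>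
  obtain T where T: "T \<subseteq> S" "card T = min (card S) (2 ^ k)"
    using obtain_subset_with_card_n[of "min (card S) (2 ^ k)" S] by auto
  have "card (S - T) = card S - card T" using T Suc.prems by (simp add: card_Diff_subset finite_subset)
  then have "card (S - T) \<le> 2 ^ k" using T Suc.prems(2) by auto
  then obtain Q2 where Q2: "cost Q2 \<le> k + c"
      "\<And>a b. g b \<in> S - T \<Longrightarrow> run Q2 a b = run (P (g b)) a b"
    using Suc.IH[of "S - T"] Suc.prems by auto
  obtain Q1 where Q1: "cost Q1 \<le> k + c" "\<And>a b. g b \<in> T \<Longrightarrow> run Q1 a b = run (P (g b)) a b"
    using Suc.IH[of T] T Suc.prems by (auto intro: finite_subset)
  show ?case
    using Q1 Q2 by (intro exI[of _ "Bob (\<lambda>b. g b \<in> T) Q1 Q2"]) auto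
qed

text \<open>Exchanging the parties transfers the statement on Bob's messages to Alice.\<close>

primrec swap_roles :: "('a, 'b) protocol \<Rightarrow> ('b, 'a) protocol" where
  "swap_roles (Output v) = Output v"
| "swap_roles (Alice s P Q) = Bob s (swap_roles P) (swap_roles Q)"
| "swap_roles (Bob s P Q) = Alice s (swap_roles P) (swap_roles Q)"

lemma run_swap_roles: "run (swap_roles P) b a = run P a b"
  by (induction P) auto

lemma cost_swap_roles: "cost (swap_roles P) = cost P"
  by (induction P) auto

lemma ex_protocol_Alice_sends:
  assumes "finite S" "card S \<le> 2 ^ k" "\<And>s. s \<in> S \<Longrightarrow> cost (P s) \<le> c"
  shows "\<exists>Q. cost Q \<le> k + c \<and> (\<forall>a b. g a \<in> S \<longrightarrow> run Q a b = run (P (g a)) a b)"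
  using ex_protocol_Bob_sends[of S k "\<lambda>s. swap_roles (P s)" c g] assms
  by (metis cost_swap_roles run_swap_roles)

section \<open>Rounding to a finite grid\<close>

text \<open>Round down to a multiple of \<open>1 / 2 ^ k\<close> in the interval from -2 to 2. There
  are \<open>4 * 2 ^ k + 1\<close> grid points; the one beyond a power of two makes the exponent
  \<open>k + 3\<close> instead of \<open>k + 2\<close>.\<close>

lemma grid_approximation:
  "\<exists>R (h :: real \<Rightarrow> real). finite R \<and> card R \<le> 2 ^ (k + 3) \<and>
     (\<forall>x. \<bar>x\<bar> \<le> 2 \<longrightarrow> h x \<in> R \<and> \<bar>x - h x\<bar> \<le> 1 / 2 ^ k)"
proof -
  define R where "R = (\<lambda>i. real i / 2 ^ k - 2) ` {..(4 * 2 ^ k :: nat)}"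
  define h where "h x = real (nat \<lfloor>(x + 2) * 2 ^ k\<rfloor>) / 2 ^ k - 2" for x :: real
  have "card R \<le> 4 * 2 ^ k + 1" unfolding R_def using card_image_le[of "{..(4 * 2 ^ k :: nat)}"] by fastforce
  also have "\<dots> \<le> 4 * 2 ^ k + 4 * 2 ^ k" by simp
  also have "\<dots> = 2 ^ (k + 3)" by (simp add: power_add)
  finally have card: "card R \<le> 2 ^ (k + 3)" .
  have "h x \<in> R \<and> \<bar>x - h x\<bar> \<le> 1 / 2 ^ k" if x: "\<bar>x\<bar> \<le> 2" for x
  proof
    define t where "t = (x + 2) * 2 ^ k"
    have t0: "t \<ge> 0" using x by (simp add: t_def)
    have "t \<le> 4 * 2 ^ k" unfolding t_def using x by (intro mult_right_mono) auto
    then have "\<lfloor>t\<rfloor> \<le> 4 * 2 ^ k"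
      by (metis floor_mono floor_of_int of_int_mult of_int_numeral of_int_power)
    then have "nat \<lfloor>t\<rfloor> \<le> 4 * 2 ^ k" by (simp add: nat_le_iff)
    then show "h x \<in> R" by (auto simp: h_def R_def t_def)
    have "x - h x = (t - real (nat \<lfloor>t\<rfloor>)) / 2 ^ k" by (simp add: h_def t_def field_simps)
    moreover have "\<bar>t - real (nat \<lfloor>t\<rfloor>)\<bar> \<le> 1" using t0 by linarith
    ultimately show "\<bar>x - h x\<bar> \<le> 1 / 2 ^ k" by (simp add: divide_right_mono)
  qed
  moreover have "finite R" by (simp add: R_def)
  ultimately show ?thesis using card by blast
qed

section \<open>Expectations as weighted sums over matrix indices\<close>

lemma sum_pmf_bitstring:
  assumes "p \<in> dists n"
  shows "(\<Sum>i<2 ^ n. pmf p (bitstring n i)) = 1"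
proof -
  have "(\<Sum>i<2 ^ n. pmf p (bitstring n i)) = (\<Sum>x\<in>cube n. pmf p x)"
    by (rule sum.reindex_bij_betw[OF bij_betw_bitstring])
  also have "\<dots> = 1"
    using assms bij_betw_finite[OF bij_betw_bitstring[of n]]
    by (intro sum_pmf_eq_1) (auto simp: dists_def)
  finally show ?thesis .
qed

lemma expectation_pair_dists:
  assumes p: "p \<in> dists n" and q: "q \<in> dists n"
  shows "measure_pmf.expectation (pair_pmf p q) (\<lambda>(x, y). f x y) =
    (\<Sum>i<2 ^ n. \<Sum>j<2 ^ n. pmf p (bitstring n i) * pmf q (bitstring n j) *
       comm_matrix n f $$ (i, j))"
proof -
  have fin: "finite (cube n)" using bij_betw_finite[OF bij_betw_bitstring[of n]] by simp
  have "measure_pmf.expectation (pair_pmf p q) (\<lambda>(x, y). f x y) =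
      (\<Sum>z\<in>cube n \<times> cube n. (case z of (x, y) \<Rightarrow> f x y) * pmf (pair_pmf p q) z)"
    using p q fin by (intro integral_measure_pmf_real) (auto simp: dists_def)
  also have "\<dots> = (\<Sum>(x, y)\<in>cube n \<times> cube n. pmf p x * pmf q y * f x y)"
    by (intro sum.cong) (auto simp: pmf_pair mult_ac)
  also have "\<dots> = (\<Sum>x\<in>cube n. \<Sum>y\<in>cube n. pmf p x * pmf q y * f x y)"
    by (simp add: sum.cartesian_product)
  also have "\<dots> = (\<Sum>i<2 ^ n. \<Sum>y\<in>cube n. pmf p (bitstring n i) * pmf q y * f (bitstring n i) y)"
    by (rule sum.reindex_bij_betw[OF bij_betw_bitstring, symmetric])
  also have "\<dots> = (\<Sum>i<2 ^ n. \<Sum>j<2 ^ n. pmf p (bitstring n i) * pmf q (bitstring n j) *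
      f (bitstring n i) (bitstring n j))"
    by (intro sum.cong refl sum.reindex_bij_betw[OF bij_betw_bitstring, symmetric])
  finally show ?thesis by (simp add: comm_matrix_def)
qed

lemma abs_weighted_sum_le:
  fixes p g :: "'a \<Rightarrow> real"
  assumes "\<And>i. i \<in> I \<Longrightarrow> p i \<ge> 0" "sum p I = 1" "\<And>i. i \<in> I \<Longrightarrow> \<bar>g i\<bar> \<le> b"
  shows "\<bar>\<Sum>i\<in>I. p i * g i\<bar> \<le> b"
proof -
  have "\<bar>\<Sum>i\<in>I. p i * g i\<bar> \<le> (\<Sum>i\<in>I. \<bar>p i * g i\<bar>)" by (rule sum_abs)
  also have "\<dots> \<le> (\<Sum>i\<in>I. p i * b)"
    using assms by (intro sum_mono) (auto simp: abs_mult intro: mult_left_mono)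
  also have "\<dots> = b" using assms(2) by (simp flip: sum_distrib_right)
  finally show ?thesis .
qed

lemma abs_double_weighted_sum_le:
  fixes p :: "'a \<Rightarrow> real" and q :: "'b \<Rightarrow> real"
  assumes "\<And>i. i \<in> I \<Longrightarrow> p i \<ge> 0" "sum p I = 1" "\<And>j. j \<in> J \<Longrightarrow> q j \<ge> 0" "sum q J = 1"
    and "\<And>i j. i \<in> I \<Longrightarrow> j \<in> J \<Longrightarrow> \<bar>g i j\<bar> \<le> b"
  shows "\<bar>\<Sum>i\<in>I. \<Sum>j\<in>J. p i * q j * g i j\<bar> \<le> b"
proof -
  have "(\<Sum>i\<in>I. \<Sum>j\<in>J. p i * q j * g i j) = (\<Sum>i\<in>I. p i * (\<Sum>j\<in>J. q j * g i j))"
    by (simp add: sum_distrib_left mult.assoc)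
  then show ?thesis using assms by (simp add: abs_weighted_sum_le)
qed

section \<open>The protocol for a given approximating matrix\<close>

text \<open>The error splits into \<open>\<epsilon> / 2\<close> for replacing \<open>f\<close> by
  \<open>B\<close>, \<open>\<epsilon> / 4\<close> for rounding Bob's coefficients and
  \<open>\<epsilon> / 4\<close> for rounding Alice's answer. Bob sends \<open>r\<close> numbers of
  \<open>n + l + 6\<close> bits each, Alice one of \<open>l + 5\<close> bits.\<close>

lemma ex_estimating_protocol:
  assumes f: "\<And>x y. x \<in> cube n \<Longrightarrow> y \<in> cube n \<Longrightarrow> f x y \<in> {-1..1}"
    and \<epsilon>: "\<epsilon> \<le> 1" "1 / 2 ^ l \<le> \<epsilon>"
    and B: "B \<in> carrier_mat (2 ^ n) (2 ^ n)"
    and AB: "\<And>i j. i < 2 ^ n \<Longrightarrow> j < 2 ^ n \<Longrightarrow> \<bar>comm_matrix n f $$ (i, j) - B $$ (i, j)\<bar> \<le> \<epsilon> / 2"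
    and r: "vec_space.rank (2 ^ n) B = r"
  shows "\<exists>P. estimates n \<epsilon> f P \<and> cost P \<le> (n + l + 6) * r + (l + 5)"
proof -
  define N :: nat where "N = 2 ^ n"
  define E where "E p q M = (\<Sum>i<N. \<Sum>j<N. pmf p (bitstring n i) * pmf q (bitstring n j) * M $$ (i, j))"
    for p q :: "bool list pmf" and M :: "real mat"
  interpret vec_space "TYPE(real)" N .
  have BN: "B \<in> carrier_mat N N" and rN: "rank B = r" using B r by (auto simp: N_def)
  have \<epsilon>0: "\<epsilon> > 0" using \<epsilon>(2) by (meson less_le_trans zero_less_divide_1_iff zero_less_numeral zero_less_power)
  have rank_le: "r \<le> N" using rank_le_nc[OF BN] rN by simp
  obtain j W where jW: "inj_on j {..<r}" "\<And>i. i < r \<Longrightarrow> j i < N"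
    "\<And>x y. x < N \<Longrightarrow> y < N \<Longrightarrow> B $$ (x, y) = (\<Sum>i<r. B $$ (x, j i) * W i y)"
    using rank_many_columns_generate[OF BN, unfolded rN] by blast
  obtain k c where kN: "\<And>i. i < r \<Longrightarrow> k i < N"
    and c1: "\<And>i y. i < r \<Longrightarrow> y < N \<Longrightarrow> \<bar>c i y\<bar> \<le> 1"
    and Bc: "\<And>x y. x < N \<Longrightarrow> y < N \<Longrightarrow> B $$ (x, y) = (\<Sum>i<r. B $$ (x, k i) * c i y)"
    using generating_columns_bounded_coefficients[of j r N N "\<lambda>x y. B $$ (x, y)" W, OF jW] by blast
  have Fbd: "\<bar>comm_matrix n f $$ (i, j)\<bar> \<le> 1" if "i < N" "j < N" for i j
    using f[of "bitstring n i" "bitstring n j"] that bij_betw_apply[OF bij_betw_bitstring[of n]]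
    by (auto simp: comm_matrix_def N_def abs_le_iff)
  \<comment> \<open>Here \<open>\<epsilon> \<le> 1\<close> enters: the entries of \<open>B\<close>
    are at most \<open>1 + \<epsilon> / 2\<close>.\<close>
  have Bbd: "\<bar>B $$ (i, j)\<bar> \<le> 3 / 2" if "i < N" "j < N" for i j
    using Fbd[OF that] AB[of i j] that \<epsilon>(1) unfolding N_def by linarith
  define \<alpha> where "\<alpha> p i = (\<Sum>x<N. pmf p (bitstring n x) * B $$ (x, k i))" for p i
  define \<beta> where "\<beta> q i = (\<Sum>y<N. pmf q (bitstring n y) * c i y)" for q i
  have \<alpha>: "\<bar>\<alpha> p i\<bar> \<le> 3 / 2" if "p \<in> dists n" "i < r" for p i
    unfolding \<alpha>_def using sum_pmf_bitstring[OF that(1)] Bbd kN[OF that(2)]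
    by (intro abs_weighted_sum_le) (auto simp: N_def)
  have \<beta>: "\<bar>\<beta> q i\<bar> \<le> 1" if "q \<in> dists n" "i < r" for q i
    unfolding \<beta>_def using sum_pmf_bitstring[OF that(1)] c1 that(2)
    by (intro abs_weighted_sum_le) (auto simp: N_def)
  have E\<alpha>\<beta>: "E p q B = (\<Sum>i<r. \<beta> q i * \<alpha> p i)" for p q
  proof -
    have "E p q B = (\<Sum>x<N. \<Sum>y<N. \<Sum>i<r.
        (pmf q (bitstring n y) * c i y) * (pmf p (bitstring n x) * B $$ (x, k i)))"
      unfolding E_def by (intro sum.cong refl) (auto simp: Bc sum_distrib_left mult_ac)
    also have "\<dots> = (\<Sum>x<N. \<Sum>i<r. \<Sum>y<N.
        (pmf q (bitstring n y) * c i y) * (pmf p (bitstring n x) * B $$ (x, k i)))"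
      by (intro sum.cong refl sum.swap)
    also have "\<dots> = (\<Sum>i<r. \<Sum>x<N. \<Sum>y<N.
        (pmf q (bitstring n y) * c i y) * (pmf p (bitstring n x) * B $$ (x, k i)))"
      by (rule sum.swap)
    also have "\<dots> = (\<Sum>i<r. \<beta> q i * \<alpha> p i)"
      unfolding \<alpha>_def \<beta>_def by (subst sum_product, subst (2) sum.swap) simp
    finally show ?thesis .
  qed
  have EF: "\<bar>E p q (comm_matrix n f) - E p q B\<bar> \<le> \<epsilon> / 2" "\<bar>E p q B\<bar> \<le> 3 / 2"
    if "p \<in> dists n" "q \<in> dists n" for p q
  proof -
    have "E p q (comm_matrix n f) - E p q B = (\<Sum>i<N. \<Sum>j<N. pmf p (bitstring n i) * pmf q (bitstring n j) *
        (comm_matrix n f $$ (i, j) - B $$ (i, j)))"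
      unfolding E_def by (simp add: sum_subtractf right_diff_distrib)
    also have "\<bar>\<dots>\<bar> \<le> \<epsilon> / 2"
      using sum_pmf_bitstring[OF that(1)] sum_pmf_bitstring[OF that(2)] AB
      by (intro abs_double_weighted_sum_le) (auto simp: N_def)
    finally show "\<bar>E p q (comm_matrix n f) - E p q B\<bar> \<le> \<epsilon> / 2" .
    show "\<bar>E p q B\<bar> \<le> 3 / 2"
      unfolding E_def using sum_pmf_bitstring[OF that(1)] sum_pmf_bitstring[OF that(2)] Bbd
      by (intro abs_double_weighted_sum_le) (auto simp: N_def)
  qed
  \<comment> \<open>In the precision, \<open>n\<close> pays for the number of summands
    \<open>r \<le> 2 ^ n\<close>, \<open>l\<close> for \<epsilon>, and 3 for the bound
    \<open>3 / 2\<close> on the \<open>\<alpha> p i\<close> and the share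
    \<open>\<epsilon> / 4\<close>. The grid adds 3 more bits.\<close>
  obtain R1 and h1 :: "real \<Rightarrow> real" where R1: "finite R1" "card R1 \<le> 2 ^ (n + l + 3 + 3)"
      "\<And>x. \<bar>x\<bar> \<le> 2 \<Longrightarrow> h1 x \<in> R1 \<and> \<bar>x - h1 x\<bar> \<le> 1 / 2 ^ (n + l + 3)"
    using grid_approximation[of "n + l + 3"] by metis
  obtain R2 and h2 :: "real \<Rightarrow> real" where R2: "finite R2" "card R2 \<le> 2 ^ (l + 2 + 3)"
      "\<And>x. \<bar>x\<bar> \<le> 2 \<Longrightarrow> h2 x \<in> R2 \<and> \<bar>x - h2 x\<bar> \<le> 1 / 2 ^ (l + 2)"
    using grid_approximation[of "l + 2"] by metis
  \<comment> \<open>The \<open>r\<close> rounded coefficients are sent as a single message, a tuple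
    from \<open>S\<close>; \<open>msg\<close> is restricted to the indices below \<open>r\<close> to
    be such a tuple.\<close>
  define S where "S = PiE {..<r} (\<lambda>_. R1)"
  define msg where "msg q = (\<lambda>i\<in>{..<r}. h1 (\<beta> q i))" for q
  define val where "val s p = (\<Sum>i<r. s i * \<alpha> p i)" for s p
  have "\<exists>Q :: (bool list pmf, bool list pmf) protocol. cost Q \<le> l + 5 \<and>
      (\<forall>p q. h2 (val s p) \<in> R2 \<longrightarrow> run Q p q = h2 (val s p))" for s
    \<comment> \<open>The family of continuations is the constructor \<open>Output\<close>: after
      receiving a grid point the protocol outputs it, at further cost \<open>0\<close>.\<close>
    using ex_protocol_Alice_sends[OF R2(1,2), of Output 0 "\<lambda>p. h2 (val s p)"]
    by (simp add: add.commute)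
  then obtain P :: "_ \<Rightarrow> (bool list pmf, bool list pmf) protocol" where
    P: "\<And>s. cost (P s) \<le> l + 5"
      "\<And>s p q. h2 (val s p) \<in> R2 \<Longrightarrow> run (P s) p q = h2 (val s p)" by metis
  have "finite S" unfolding S_def using R1(1) by (intro finite_PiE) auto
  moreover have "card S \<le> 2 ^ ((n + l + 6) * r)"
    using power_mono[OF R1(2), of r] by (simp add: S_def card_PiE power_mult add.commute)
  ultimately obtain Q where Q: "cost Q \<le> (n + l + 6) * r + (l + 5)"
      "\<And>p q. msg q \<in> S \<Longrightarrow> run Q p q = run (P (msg q)) p q"
    using ex_protocol_Bob_sends[of S "(n + l + 6) * r" P "l + 5" msg] P(1) by metis
  have "\<bar>run Q p q - E p q (comm_matrix n f)\<bar> \<le> \<epsilon>" if p: "p \<in> dists n" and q: "q \<in> dists n" for p q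
  proof -
    have h1: "h1 (\<beta> q i) \<in> R1 \<and> \<bar>\<beta> q i - h1 (\<beta> q i)\<bar> \<le> 1 / 2 ^ (n + l + 3)" if "i < r" for i
      using R1(3)[of "\<beta> q i"] \<beta>[OF q that] by linarith
    then have "msg q \<in> S" by (auto simp: S_def msg_def)
    have "\<bar>val (msg q) p - E p q B\<bar> = \<bar>\<Sum>i<r. (h1 (\<beta> q i) - \<beta> q i) * \<alpha> p i\<bar>"
      unfolding E\<alpha>\<beta> val_def msg_def by (simp add: sum_subtractf left_diff_distrib)
    also have "\<dots> \<le> (\<Sum>i<r. \<bar>(h1 (\<beta> q i) - \<beta> q i) * \<alpha> p i\<bar>)" by (rule sum_abs)
    also have "\<dots> \<le> (\<Sum>i<r. 1 / 2 ^ (n + l + 3) * (3 / 2))"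
    proof (rule sum_mono)
      fix i assume "i \<in> {..<r}"
      then show "\<bar>(h1 (\<beta> q i) - \<beta> q i) * \<alpha> p i\<bar> \<le> 1 / 2 ^ (n + l + 3) * (3 / 2)"
        unfolding abs_mult using h1[of i] \<alpha>[OF p, of i]
        by (intro mult_mono) (auto simp: abs_minus_commute)
    qed
    also have "\<dots> = real r * (1 / 2 ^ (n + l + 3) * (3 / 2))" by simp
    also have "\<dots> \<le> 2 ^ n * (1 / 2 ^ (n + l + 3) * (3 / 2))"
    proof (rule mult_right_mono)
      have "real r \<le> real N" using rank_le by simp
      then show "real r \<le> 2 ^ n" by (simp add: N_def)
    qed simp
    also have "\<dots> = 3 / 16 * (1 / 2 ^ l)" by (simp add: power_add)
    also have "\<dots> \<le> \<epsilon> / 4" using \<epsilon>(2) \<epsilon>0 by linarith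
    finally have v: "\<bar>val (msg q) p - E p q B\<bar> \<le> \<epsilon> / 4" .
    \<comment> \<open>The rounded sum is at most \<open>3 / 2 + 1 / 4\<close>, hence in the range of
      the second grid.\<close>
    then have "\<bar>val (msg q) p\<bar> \<le> 2" using EF(2)[OF p q] \<epsilon>(1) by linarith
    then have h2: "h2 (val (msg q) p) \<in> R2"
        "\<bar>val (msg q) p - h2 (val (msg q) p)\<bar> \<le> 1 / 2 ^ (l + 2)"
      using R2(3) by auto
    have "1 / 2 ^ (l + 2) \<le> \<epsilon> / 4" using \<epsilon>(2) by (simp add: power_add)
    moreover have "run Q p q = h2 (val (msg q) p)" using Q(2) P(2) h2(1) \<open>msg q \<in> S\<close> by simp
    ultimately show ?thesis using v h2(2) EF(1)[OF p q] by linarith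
  qed
  then have "estimates n \<epsilon> f Q"
    unfolding estimates_def by (simp add: expectation_pair_dists E_def N_def)
  then show ?thesis using Q(1) by blast
qed

section \<open>Cases without communication\<close>

text \<open>A matrix of rank 0 vanishes, being a combination of no columns, so every entry of
  \<open>f\<close> and every average of them is within \<epsilon> of 0.\<close>

lemma estimates_Output_0:
  assumes B: "B \<in> carrier_mat (2 ^ n) (2 ^ n)"
    and AB: "\<And>i j. i < 2 ^ n \<Longrightarrow> j < 2 ^ n \<Longrightarrow> \<bar>comm_matrix n f $$ (i, j) - B $$ (i, j)\<bar> \<le> \<epsilon>"
    and r: "vec_space.rank (2 ^ n) B = 0"
  shows "estimates n \<epsilon> f (Output 0)"
proof -
  interpret vec_space "TYPE(real)" "2 ^ n" .
  have "B $$ (i, j) = 0" if "i < 2 ^ n" "j < 2 ^ n" for i j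
    by (rule rank_many_columns_generate[OF B, unfolded r]) (use that in simp)
  then have "\<bar>comm_matrix n f $$ (i, j)\<bar> \<le> \<epsilon>" if "i < 2 ^ n" "j < 2 ^ n" for i j
    using AB that by (metis diff_zero)
  then show ?thesis
    unfolding estimates_def
    by (auto simp: expectation_pair_dists sum_pmf_bitstring intro!: abs_double_weighted_sum_le)
qed

text \<open>On the one-point cube each party can only hold the point mass at
  \<open>[]\<close>.\<close>

lemma estimates_trivial_cube:
  assumes "\<epsilon> \<ge> 0"
  shows "estimates 0 \<epsilon> f (Output (f [] []))"
proof -
  have "pmf p [] = 1" if "p \<in> dists 0" for p
    using sum_pmf_bitstring[OF that] by (simp add: bitstring_def)
  then show ?thesis
    using assms unfolding estimates_def
    by (auto simp: expectation_pair_dists comm_matrix_def bitstring_def)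
qed

section \<open>From protocols and matrices to the two complexity measures\<close>

lemma D_bar_le: "estimates n \<epsilon> f P \<Longrightarrow> D_bar n \<epsilon> f \<le> enat (cost P)"
  unfolding D_bar_def by (rule Inf_lower) blast

text \<open>The set of ranks is nonempty, as \<open>comm_matrix n f\<close> approximates itself, and
  an infimum of a nonempty set of naturals is attained.\<close>

lemma approx_rank_attained:
  assumes "\<epsilon> \<ge> 0"
  obtains B where "B \<in> carrier_mat (2 ^ n) (2 ^ n)"
    "\<And>i j. i < 2 ^ n \<Longrightarrow> j < 2 ^ n \<Longrightarrow> \<bar>comm_matrix n f $$ (i, j) - B $$ (i, j)\<bar> \<le> \<epsilon>"
    "vec_space.rank (2 ^ n) B = approx_rank n \<epsilon> f"
proof -
  let ?S = "{vec_space.rank (2 ^ n) B | B. B \<in> carrier_mat (2 ^ n) (2 ^ n) \<and>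
     (\<forall>i<2 ^ n. \<forall>j<2 ^ n. \<bar>comm_matrix n f $$ (i, j) - B $$ (i, j)\<bar> \<le> \<epsilon>)}"
  have "comm_matrix n f \<in> carrier_mat (2 ^ n) (2 ^ n)" by (simp add: comm_matrix_def)
  then have "vec_space.rank (2 ^ n) (comm_matrix n f) \<in> ?S" using assms by auto
  then have "approx_rank n \<epsilon> f \<in> ?S" unfolding approx_rank_def by (intro Inf_nat_def1) blast
  then show ?thesis using that by auto
qed

theorem theorem2p9:
  shows "\<exists>C::real. C > 0 \<and>
    (\<forall>(n::nat) (f :: bool list \<Rightarrow> bool list \<Rightarrow> real) (\<epsilon>::real) (r::nat).
       (\<forall>x\<in>cube n. \<forall>y\<in>cube n. f x y \<in> {-1..1}) \<longrightarrow> \<epsilon> \<in> {0<..1} \<longrightarrow>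
       approx_rank n (\<epsilon> / 2) f = r \<longrightarrow>
       ereal_of_enat (D_bar n \<epsilon> f) \<le>
         ereal (C * (real r * real n + real r * log 2 (1 / \<epsilon>))))"
proof (intro exI[of _ 14] conjI allI impI)
  fix n f \<epsilon> r
  assume f: "\<forall>x\<in>cube n. \<forall>y\<in>cube n. f x y \<in> {-1..1}" and "\<epsilon> \<in> {0<..1}"
    and r: "approx_rank n (\<epsilon> / 2) f = r"
  then have \<epsilon>: "0 < \<epsilon>" "\<epsilon> \<le> 1" by auto
  define L where "L = log 2 (1 / \<epsilon>)"
  have L0: "L \<ge> 0" using \<epsilon> by (simp add: L_def)
  obtain B where B: "B \<in> carrier_mat (2 ^ n) (2 ^ n)"
    "\<And>i j. i < 2 ^ n \<Longrightarrow> j < 2 ^ n \<Longrightarrow> \<bar>comm_matrix n f $$ (i, j) - B $$ (i, j)\<bar> \<le> \<epsilon> / 2"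
    "vec_space.rank (2 ^ n) B = r"
    using approx_rank_attained[of "\<epsilon> / 2" n f] \<epsilon> r by auto
  have "\<exists>P. estimates n \<epsilon> f P \<and> real (cost P) \<le> 14 * (real r * real n + real r * L)"
  proof (cases "n = 0 \<or> r = 0")
    case True
    then have "\<exists>v. estimates n \<epsilon> f (Output v)"
    proof
      assume "n = 0"
      then show ?thesis using estimates_trivial_cube[of \<epsilon> f] \<epsilon> by auto
    next
      assume "r = 0"
      then show ?thesis using estimates_Output_0[OF B(1), of f \<epsilon>] B(2,3) \<epsilon>(1) by force
    qed
    \<comment> \<open>A bare \<open>Output\<close> costs 0, and the bound is nonnegative since
      \<open>L \<ge> 0\<close>.\<close>
    then show ?thesis using L0 by fastforce
  next
    case False
    \<comment> \<open>The least whole number of bits with \<open>1 / 2 ^ l \<le> \<epsilon>\<close>;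
      rounding up costs at most 1 over \<open>L\<close>.\<close>
    define l where "l = nat \<lceil>L\<rceil>"
    have lL: "L \<le> real l" "real l \<le> L + 1" using L0 unfolding l_def by linarith+
    have "1 / \<epsilon> \<le> 2 powr real l"
      using lL(1) \<epsilon> unfolding L_def by (simp add: log_le_iff)
    then have "1 / \<epsilon> \<le> 2 ^ l" by (simp add: powr_realpow)
    then have "1 / 2 ^ l \<le> \<epsilon>" using \<epsilon> by (simp add: field_simps)
    then obtain P where P: "estimates n \<epsilon> f P" "cost P \<le> (n + l + 6) * r + (l + 5)"
      using ex_estimating_protocol[of n f \<epsilon> l B r] f \<epsilon> B by blast
    have "real (cost P) \<le> real ((n + l + 6) * r + (l + 5))" using P(2) of_nat_le_iff by blast
    also have "\<dots> = (real n + real l + 6) * real r + (real l + 5)" by simp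
    also have "\<dots> \<le> (real n + L + 7) * real r + (L + 6)"
      using mult_right_mono[of "real n + real l + 6" "real n + L + 7" "real r"] lL by simp
    also have "\<dots> \<le> 14 * (real r * real n + real r * L)"
    proof -
      \<comment> \<open>With \<open>n\<close> and \<open>r\<close> positive, \<open>7 * r\<close>
        and 6 are absorbed into multiples of \<open>r * n\<close>, and the single \<open>L\<close>
        into \<open>r * L\<close>. The coefficient of \<open>r * n\<close> becomes 1 + 7 + 6 = 14,
        that of \<open>r * L\<close> only 2.\<close>
      have "1 * real r \<le> real n * real r" "1 * L \<le> real r * L" "1 * 1 \<le> real n * real r"
        using False L0 by (intro mult_right_mono mult_mono; simp)+
      moreover have "real r * L \<ge> 0" using L0 by simp
      ultimately show ?thesis by (simp add: algebra_simps)
    qed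
    finally show ?thesis using P(1) by blast
  qed
  then obtain P where P: "estimates n \<epsilon> f P" "real (cost P) \<le> 14 * (real r * real n + real r * L)"
    by blast
  have "ereal_of_enat (D_bar n \<epsilon> f) \<le> ereal_of_enat (enat (cost P))"
    using D_bar_le[OF P(1)] by (simp only: ereal_of_enat_le_iff)
  also have "\<dots> \<le> ereal (14 * (real r * real n + real r * L))" using P(2) by simp
  finally show "ereal_of_enat (D_bar n \<epsilon> f) \<le> ereal (14 * (real r * real n + real r * log 2 (1 / \<epsilon>)))"
    by (simp add: L_def)
qed simp

end
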